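(* Let $\alpha\in[0,1)$, $q\in(0,1)$, $\nu>-1$. Suppose that $$4(1-q)(1-q^{\nu})-q^{\nu}>0$$ and $$\alpha\geq\frac{2q^{3\nu}-24q^{2\nu}(1-q)(1-q^{\nu})+112q^{\nu}(1-q)^{2}(1-q^{\nu})^{2}-64(1-q)^{3}(1-q^{\nu})^{3}}{2q^{3\nu}-24q^{2\nu}(1-q)(1-q^{\nu})+80q^{\nu}(1-q)^{2}(1-q^{\nu})^{2}-64(1-q)^{3}(1-q^{\nu})^{3}}.$$ Then $h_{\nu}^{(2)}(z;q)\in\mathcal{H}^{\frac{1}{1-2\alpha}}$ for $\alpha\in\left[0,\frac{1}{2}\right)$, and $h_{\nu}^{(2)}(z;q)\in\mathcal{H}^{\infty}$ for $\alpha\in\left(\frac{1}{2},1\right)$.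
   Context: $\mathbb{U}=\{z\in\mathbb{C}:|z|<1\}$. For $0<p\leq\infty$, the Hardy space $\mathcal{H}^p$ is the set of analytic functions $f$ in $\mathbb{U}$ for which $\{M_p(r,f):r\in[0,1)\}$ is bounded, where $M_p(r,f)=\left(\frac{1}{2\pi}\int_0^{2\pi}|f(re^{i\theta})|^p\,d\theta\right)^{1/p}$ for $0<p<\infty$ and $M_\infty(r,f)=\sup_{0\leq\theta<2\pi}|f(re^{i\theta})|$. In particular $\mathcal{H}^\infty$ is the class of bounded analytic functions in $\mathbb{U}$. For $q\in(0,1)$: $(a;q)_0=1$ and $(a;q)_n=\prod_{k=1}^{n}(1-aq^{k-1})$. The normalized Jackson second $q$-Bessel function is, for $\nu>-1$ and $z\in\mathbb{U}$, $$h_{\nu}^{(2)}(z;q)=z+\sum_{n\geq2}\frac{(-1)^{n-1}q^{(n-1)(n-1+\nu)}}{4^{n-1}(q;q)_{n-1}(q^{\nu+1};q)_{n-1}}z^{n}.$$ *)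

theory Defs
  imports "HOL-Complex_Analysis.Complex_Analysis"
begin

text \<open>
  The mean \<open>M\<^sub>p(r, f)\<close> of a function over the circle of radius \<open>r\<close>. It is meant
  for \<open>0 < p \<le> \<infinity>\<close>, \<open>0 \<le> r < 1\<close> and \<open>f\<close> analytic in the unit disc, in which case the
  integrand is continuous and the supremum is that of a bounded set.
\<close>
definition hardy_mean :: "ennreal \<Rightarrow> real \<Rightarrow> (complex \<Rightarrow> complex) \<Rightarrow> real" where
  "hardy_mean p r f =
     (if p = \<infinity> then (SUP \<theta>\<in>{0..<2 * pi}. norm (f (of_real r * cis \<theta>)))
      else (1 / (2 * pi) *
              integral {0..2 * pi} (\<lambda>\<theta>. norm (f (of_real r * cis \<theta>)) powr enn2real p))
           powr (1 / enn2real p))"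

text \<open>
  Functions are total on the complex numbers, but membership only depends on their
  values in the open unit disc.
\<close>
definition hardy_space :: "ennreal \<Rightarrow> (complex \<Rightarrow> complex) set" where
  "hardy_space p =
     {f. f holomorphic_on ball 0 1 \<and> bounded ((\<lambda>r. hardy_mean p r f) ` {0..<1})}"

definition q_pochhammer :: "real \<Rightarrow> real \<Rightarrow> nat \<Rightarrow> real" where
  "q_pochhammer a q n = (\<Prod>k=1..n. 1 - a * q ^ (k - 1))"

definition jackson2_coeff :: "real \<Rightarrow> real \<Rightarrow> nat \<Rightarrow> real" where
  "jackson2_coeff \<nu> q n =
     (-1) ^ (n - 1) * q powr (real (n - 1) * (real (n - 1) + \<nu>)) /
     (4 ^ (n - 1) * q_pochhammer q q (n - 1) * q_pochhammer (q powr (\<nu> + 1)) q (n - 1))"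

text \<open>
  The series ranges over the indices \<open>n \<ge> 2\<close>, hence the shift by two.
\<close>
definition jackson2_bessel_normalized :: "real \<Rightarrow> real \<Rightarrow> complex \<Rightarrow> complex" where
  "jackson2_bessel_normalized \<nu> q z =
     z + (\<Sum>n. of_real (jackson2_coeff \<nu> q (n + 2)) * z ^ (n + 2))"

end

theory Submission
  imports Defs
begin

text \<open>
  The series defining the function converges absolutely on the closed unit disc (its
  coefficients decay faster than geometrically), so the function is holomorphic and bounded
  in the open disc and hence belongs to every Hardy space. The condition
  \<open>4 (1 - q) (1 - q\<^sup>\<nu>) > q\<^sup>\<nu>\<close> gives the ratio bound \<open>q\<close>
  for the coefficients directly.
\<close>

text \<open>The factor \<open>1 / (2 * pi)\<close> makes the circle have total mass 1, so a uniform
  bound on \<open>f\<close> survives both integration and the passage to the supremum.\<close>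

lemma norm_hardy_mean_le:
  assumes p: "0 < p" and r: "0 \<le> r" "r < 1"
    and bound: "\<And>z. z \<in> ball 0 1 \<Longrightarrow> norm (f z) \<le> B"
  shows "norm (hardy_mean p r f) \<le> B"
proof -
  have le: "norm (f (of_real r * cis \<theta>)) \<le> B" for \<theta>
    using r by (intro bound) (simp add: norm_mult)
  \<comment> \<open>Nonnegativity is what lets \<open>(B powr s) powr (1 / s)\<close> collapse to
    \<open>B\<close> below.\<close>
  have B: "0 \<le> B"
    using le[of 0] norm_ge_zero order_trans by blast
  show ?thesis
  proof (cases "p = \<infinity>")
    case True
    have "bdd_above ((\<lambda>\<theta>. norm (f (of_real r * cis \<theta>))) ` {0..<2 * pi})"
      using le by (intro bdd_aboveI2)
    \<comment> \<open>The value at angle 0 bounds the supremum from below, which disposes of the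
      outer norm.\<close>
    then have "0 \<le> (SUP \<theta>\<in>{0..<2 * pi}. norm (f (of_real r * cis \<theta>)))"
      by (intro cSUP_upper2[where x = 0]) auto
    moreover have "(SUP \<theta>\<in>{0..<2 * pi}. norm (f (of_real r * cis \<theta>))) \<le> B"
      using le by (intro cSUP_least) auto
    ultimately show ?thesis
      using True by (simp add: hardy_mean_def)
  next
    case False
    define s where "s = enn2real p"
    have s: "s > 0"
      using p False by (simp add: s_def enn2real_positive_iff less_top)
    define g where "g = (\<lambda>\<theta>. norm (f (of_real r * cis \<theta>)) powr s)"
    have g: "0 \<le> g \<theta>" "g \<theta> \<le> B powr s" for \<theta>
      using le s by (auto simp: g_def intro!: powr_mono2)
    have "0 \<le> integral {0..2 * pi} g \<and> integral {0..2 * pi} g \<le> 2 * pi * B powr s"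
    proof (cases "g integrable_on {0..2 * pi}")
      case True
      then have "integral {0..2 * pi} g \<le> integral {0..2 * pi} (\<lambda>_. B powr s)"
        using g by (intro integral_le) auto
      then show ?thesis
        using True g by (auto intro: integral_nonneg)
    next
      \<comment> \<open>Here the integral takes its default value 0, which satisfies both
        bounds.\<close>
      case False
      then show ?thesis
        by (simp add: not_integrable_integral)
    qed
    then have "(1 / (2 * pi) * integral {0..2 * pi} g) powr (1 / s) \<le> (B powr s) powr (1 / s)"
      using s by (intro powr_mono2) (auto simp: field_simps)
    also have "\<dots> = B"
      using s B by (simp add: powr_powr)
    finally show ?thesis
      using False by (simp add: hardy_mean_def g_def s_def)
  qed
qed

lemma bounded_holomorphic_in_hardy_space:
  assumes "f holomorphic_on ball 0 1" and "bounded (f ` ball 0 1)" and "0 < p"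
  shows "f \<in> hardy_space p"
proof -
  obtain B where "\<And>z. z \<in> ball 0 1 \<Longrightarrow> norm (f z) \<le> B"
    using assms(2) unfolding bounded_iff by blast
  then have "norm (hardy_mean p r f) \<le> B" if "r \<in> {0..<1}" for r
    using that \<open>0 < p\<close> by (intro norm_hardy_mean_le) auto
  then have "bounded ((\<lambda>r. hardy_mean p r f) ` {0..<1})"
    unfolding bounded_iff by blast
  then show ?thesis
    using assms(1) by (simp add: hardy_space_def)
qed

text \<open>On the unit disc the terms are dominated by \<open>norm (a n)\<close>, uniformly in
  \<open>z\<close>; the sum of these norms is the bound.\<close>

lemma power_series_holomorphic_bounded:
  fixes a :: "nat \<Rightarrow> complex"
  assumes "summable (\<lambda>n. norm (a n))"
  shows "(\<lambda>z. \<Sum>n. a n * z ^ n) holomorphic_on ball 0 1"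
    and "bounded ((\<lambda>z. \<Sum>n. a n * z ^ n) ` ball 0 1)"
proof -
  have le: "norm (a n * z ^ n) \<le> norm (a n)" if "z \<in> ball 0 1" for z n
    using that by (simp add: norm_mult norm_power mult_left_le power_le_one)
  then have sm: "summable (\<lambda>n. norm (a n * z ^ n))" if "z \<in> ball 0 1" for z
    using that by (intro summable_comparison_test'[OF assms]) auto
  show "(\<lambda>z. \<Sum>n. a n * z ^ n) holomorphic_on ball 0 1"
    using summable_sums[OF summable_norm_cancel[OF sm]]
    by (intro power_series_holomorphic[where a = a]) simp
  have "norm (\<Sum>n. a n * z ^ n) \<le> (\<Sum>n. norm (a n))" if "z \<in> ball 0 1" for z
    using summable_norm[OF sm[OF that]] suminf_le[OF le[OF that] sm[OF that] assms]
    by linarith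
  then show "bounded ((\<lambda>z. \<Sum>n. a n * z ^ n) ` ball 0 1)"
    unfolding bounded_iff by blast
qed

lemma q_pochhammer_Suc: "q_pochhammer a q (Suc n) = q_pochhammer a q n * (1 - a * q ^ n)"
  by (simp add: q_pochhammer_def)

text \<open>The exponent k(k + \<nu>) grows by 2k + 1 + \<nu> from k to k + 1, and each Pochhammer
  symbol gains one factor. Indices are written as successors so that the truncated subtraction
  \<open>n - 1\<close> disappears.\<close>

lemma jackson2_coeff_Suc:
  assumes "0 < q"
  shows "jackson2_coeff \<nu> q (Suc (Suc n)) = jackson2_coeff \<nu> q (Suc n) *
    - (q ^ (2 * n + 1) * q powr \<nu> / (4 * (1 - q ^ (n + 1)) * (1 - q powr \<nu> * q ^ (n + 1))))"
proof -
  have "real (Suc n) * (real (Suc n) + \<nu>) = real n * (real n + \<nu>) + (real (2 * n + 1) + \<nu>)"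
    by (simp add: algebra_simps)
  then have "q powr (real (Suc n) * (real (Suc n) + \<nu>)) =
      q powr (real n * (real n + \<nu>)) * (q ^ (2 * n + 1) * q powr \<nu>)"
    using assms by (simp only: powr_add powr_realpow)
  moreover have "q powr (\<nu> + 1) = q powr \<nu> * q"
    using assms by (simp add: powr_add)
  ultimately show ?thesis
    by (simp add: jackson2_coeff_def q_pochhammer_Suc mult_ac
        del: of_nat_Suc left_diff_distrib_numeral right_diff_distrib_numeral)
qed

text \<open>Ratio test: the hypothesis makes the denominator of the ratio at least
  \<open>q powr \<nu>\<close>, which cancels against the numerator and leaves a power of
  \<open>q\<close> that is at most \<open>q\<close>.\<close>

lemma summable_norm_jackson2_coeff:
  assumes q: "0 < q" "q < 1" and pos: "4 * (1 - q) * (1 - q powr \<nu>) - q powr \<nu> > 0"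
  shows "summable (\<lambda>n. norm (jackson2_coeff \<nu> q (n + 2)))"
proof (rule summable_ratio_test[where c = q and N = 0])
  fix n :: nat
  \<comment> \<open>The recurrence at \<open>m\<close> relates the coefficients of index
    \<open>n + 2\<close> and \<open>n + 3\<close>.\<close>
  define m where "m = Suc n"
  define x where "x = q powr \<nu>"
  have x: "0 < x" "x < 4 * (1 - q) * (1 - x)"
    using q pos by (auto simp: x_def)
  \<comment> \<open>Otherwise the right-hand side of the bound on \<open>x\<close> would be
    nonpositive.\<close>
  then have x1: "x < 1"
    using q by (smt (verit) mult_nonneg_nonpos)
  have qm: "q ^ (m + 1) \<le> q" "q ^ (2 * m + 1) \<le> q"
    using q by (simp_all add: mult_left_le power_le_one)
  have qm1: "q ^ (m + 1) \<le> 1"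
    using qm q by linarith
  have xm: "x * q ^ (m + 1) \<le> x"
    using x q by (simp add: mult_left_le power_le_one flip: power_Suc)
  \<comment> \<open>Both factors only grow when \<open>q\<close> and \<open>x\<close> are replaced
    by the smaller \<open>q ^ (m + 1)\<close> and \<open>x * q ^ (m + 1)\<close>.\<close>
  have "4 * (1 - q) * (1 - x) \<le> 4 * (1 - q ^ (m + 1)) * (1 - x * q ^ (m + 1))"
    using qm qm1 xm x1 q by (intro mult_mono) auto
  then have D: "x \<le> 4 * (1 - q ^ (m + 1)) * (1 - x * q ^ (m + 1))" (is "x \<le> ?D")
    using x by linarith
  have "q ^ (2 * m + 1) * x \<le> q * ?D"
    using qm D x q by (intro mult_mono) auto
  then have R: "\<bar>q ^ (2 * m + 1) * x / ?D\<bar> \<le> q"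
    using D x q by (simp add: divide_le_eq)
  have "norm (jackson2_coeff \<nu> q (Suc n + 2)) =
      norm (jackson2_coeff \<nu> q (n + 2)) * \<bar>q ^ (2 * m + 1) * x / ?D\<bar>"
    using jackson2_coeff_Suc[OF q(1), of \<nu> m]
    by (simp add: m_def x_def abs_mult abs_divide)
  also have "\<dots> \<le> norm (jackson2_coeff \<nu> q (n + 2)) * q"
    using R by (intro mult_left_mono) auto
  finally show "norm (norm (jackson2_coeff \<nu> q (Suc n + 2)))
      \<le> q * norm (norm (jackson2_coeff \<nu> q (n + 2)))"
    by (simp add: mult.commute)
qed (use q in auto)

lemma jackson2_bessel_normalized_holomorphic_bounded:
  assumes "0 < q" "q < 1" and "4 * (1 - q) * (1 - q powr \<nu>) - q powr \<nu> > 0"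
  shows "jackson2_bessel_normalized \<nu> q holomorphic_on ball 0 1"
    and "bounded (jackson2_bessel_normalized \<nu> q ` ball 0 1)"
proof -
  \<comment> \<open>The separate term \<open>z\<close> and the shifted series are merged into one
    power series, with 0 and 1 as its first two coefficients.\<close>
  define a where "a n = (if n = 0 then 0 else if n = 1 then 1
    else complex_of_real (jackson2_coeff \<nu> q n))" for n
  have a2: "a (n + 2) = of_real (jackson2_coeff \<nu> q (n + 2))" for n
    by (simp add: a_def)
  have sm: "summable (\<lambda>n. norm (a n))"
    using summable_norm_jackson2_coeff[OF assms]
    by (subst summable_iff_shift[of _ 2, symmetric]) (simp add: a2 del: add_2_eq_Suc')
  have eq: "(\<Sum>n. a n * z ^ n) = jackson2_bessel_normalized \<nu> q z" if "z \<in> ball 0 1" for z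
  proof -
    have "summable (\<lambda>n. a n * z ^ n)"
      using that by (intro summable_norm_cancel[OF summable_comparison_test'[OF sm, of 0]])
        (simp add: norm_mult norm_power mult_left_le power_le_one)
    from suminf_split_initial_segment[OF this, of 2] show ?thesis
      by (simp add: a2 a_def jackson2_bessel_normalized_def numeral_2_eq_2)
  qed
  show "jackson2_bessel_normalized \<nu> q holomorphic_on ball 0 1"
    by (rule holomorphic_transform[OF power_series_holomorphic_bounded(1)[OF sm] eq])
  show "bounded (jackson2_bessel_normalized \<nu> q ` ball 0 1)"
    using power_series_holomorphic_bounded(2)[OF sm] eq by (simp cong: image_cong_simp)
qed

theorem theorem4:
  fixes \<alpha> q \<nu> :: real
  assumes "0 \<le> \<alpha>" and "\<alpha> < 1"
    and "0 < q" and "q < 1"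
    and "\<nu> > -1"
    and "4 * (1 - q) * (1 - q powr \<nu>) - q powr \<nu> > 0"
    and "2 * q powr (3 * \<nu>) - 24 * q powr (2 * \<nu>) * (1 - q) * (1 - q powr \<nu>)
          + 80 * q powr \<nu> * (1 - q)^2 * (1 - q powr \<nu>)^2
          - 64 * (1 - q)^3 * (1 - q powr \<nu>)^3 \<noteq> 0"
    and "\<alpha> \<ge>
         (2 * q powr (3 * \<nu>) - 24 * q powr (2 * \<nu>) * (1 - q) * (1 - q powr \<nu>)
          + 112 * q powr \<nu> * (1 - q)^2 * (1 - q powr \<nu>)^2
          - 64 * (1 - q)^3 * (1 - q powr \<nu>)^3) /
         (2 * q powr (3 * \<nu>) - 24 * q powr (2 * \<nu>) * (1 - q) * (1 - q powr \<nu>)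
          + 80 * q powr \<nu> * (1 - q)^2 * (1 - q powr \<nu>)^2
          - 64 * (1 - q)^3 * (1 - q powr \<nu>)^3)"
  shows "(\<alpha> < 1 / 2 \<longrightarrow>
            jackson2_bessel_normalized \<nu> q \<in> hardy_space (ennreal (1 / (1 - 2 * \<alpha>)))) \<and>
         (\<alpha> > 1 / 2 \<longrightarrow>
            jackson2_bessel_normalized \<nu> q \<in> hardy_space \<infinity>)"
  \<comment> \<open>Boundedness gives every positive exponent at once, so both cases are alike; for
    \<alpha> < 1/2 the exponent 1/(1 - 2\<alpha>) is positive.\<close>
  using assms
  by (auto intro!: bounded_holomorphic_in_hardy_space
      jackson2_bessel_normalized_holomorphic_bounded)

end
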